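(* Let $(\Omega,\Sigma,P)$ be a probability space, $N$ a random variable on $\Omega$ with values in a set $R_N\subseteq\mathbb N_0$ containing $0$, $\Theta$ a $d$-dimensional random vector on $\Omega$ with values in $D\subseteq\mathbb R^d$, and $\{P_\theta\}_{\theta\in D}$ a regular conditional probability of $P$ over $P_\Theta$ consistent with $\Theta$. Let $a,b:D\to\mathbb R$ be $\mathfrak B(D)$-measurable functions. The following statements are equivalent: (i) $P_N\in\mathbf{Panjer}(a(\Theta),b(\Theta);0)$, i.e. for every $n\in R_N\setminus\{0\}$, $$P(N=n\mid\Theta)=\Big(a(\Theta)+\frac{b(\Theta)}{n}\Big)\cdot P(N=n-1\mid\Theta)\quad P\text{-almost surely};$$ (ii) $(P_\theta)_N\in\mathbf{Panjer}(a(\theta),b(\theta);0)$ for $P_\Theta$-almost all $\theta\in D$, i.e. for $P_\Theta$-almost all $\theta\in D$, $$P_\theta(N=n)=\Big(a(\theta)+\frac{b(\theta)}{n}\Big)\cdot P_\theta(N=n-1)\quad\text{for every } n\in R_N\setminus\{0\}.$$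
   Context: $\mathbb N_0=\{0,1,2,\dots\}$. $\mathfrak B(D)$ is the Borel $\sigma$-algebra of $D\subseteq\mathbb R^d$. $P_\Theta$ is the distribution of $\Theta$ under $P$ on $(D,\mathfrak B(D))$; $P_N$ and $(P_\theta)_N$ are the distributions of $N$ under $P$ and under $P_\theta$. A family $\{P_\theta\}_{\theta\in D}$ of probability measures on $\Sigma$ is a regular conditional probability of $P$ over $P_\Theta$ consistent with $\Theta$ if: (d1) for each $E\in\Sigma$ the map $\theta\mapsto P_\theta(E)$ is $\mathfrak B(D)$-measurable; (d2) $\int_D P_\theta(E)\,P_\Theta(d\theta)=P(E)$ for each $E\in\Sigma$; and (consistency) for each $B\in\mathfrak B(D)$, $P_\theta(\Theta^{-1}[B])=1$ for $P_\Theta$-almost all $\theta\in B$. *)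

theory Defs
  imports "HOL-Probability.Probability"
begin

text \<open>
  The Borel \<open>\<sigma>\<close>-algebra of \<open>D\<close> is the trace of the ambient one; \<open>D\<close> itself need not be a Borel set.
\<close>

abbreviation borel_of :: "'b::topological_space set \<Rightarrow> 'b measure" where
  "borel_of D \<equiv> restrict_space borel D"

definition law_on ::
  "'a measure \<Rightarrow> 'b::topological_space set \<Rightarrow> ('a \<Rightarrow> 'b) \<Rightarrow> 'b measure" where
  "law_on M D \<Theta> = distr M (borel_of D) \<Theta>"

definition consistent_rcp ::
  "'a measure \<Rightarrow> 'b::topological_space set \<Rightarrow> ('a \<Rightarrow> 'b) \<Rightarrow> ('b \<Rightarrow> 'a measure) \<Rightarrow> bool" where
  "consistent_rcp M D \<Theta> Pt \<longleftrightarrow>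
     (\<forall>\<theta>\<in>D. prob_space (Pt \<theta>) \<and> sets (Pt \<theta>) = sets M) \<and>
     (\<forall>E\<in>sets M. (\<lambda>\<theta>. measure (Pt \<theta>) E) \<in> borel_measurable (borel_of D)) \<and>
     (\<forall>E\<in>sets M. (LINT \<theta>|law_on M D \<Theta>. measure (Pt \<theta>) E) = measure M E) \<and>
     (\<forall>B\<in>sets (borel_of D). AE \<theta> in law_on M D \<Theta>.
        \<theta> \<in> B \<longrightarrow> measure (Pt \<theta>) (\<Theta> -` B \<inter> space M) = 1)"

text \<open>\<open>P(E | \<Theta>)\<close>, i.e. a version of the conditional expectation of the indicator of \<open>E\<close> given \<open>\<sigma>(\<Theta>)\<close>.\<close>

definition cond_prob_given ::
  "'a measure \<Rightarrow> 'b::topological_space set \<Rightarrow> ('a \<Rightarrow> 'b) \<Rightarrow> 'a set \<Rightarrow> 'a \<Rightarrow> real" where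
  "cond_prob_given M D \<Theta> E =
     real_cond_exp M (vimage_algebra (space M) \<Theta> (borel_of D)) (indicator E)"

text \<open>
  Membership of a distribution \<open>Q\<close> on \<open>\<nat>\<close> in the Panjer class with parameters \<open>\<alpha>\<close>, \<open>\<beta>\<close> and
  index \<open>0\<close>; the recursion is required only at the nonzero points of the value set \<open>R\<close>.
\<close>

definition panjer0 :: "nat set \<Rightarrow> real \<Rightarrow> real \<Rightarrow> nat measure \<Rightarrow> bool" where
  "panjer0 R \<alpha> \<beta> Q \<longleftrightarrow>
     (\<forall>n\<in>R - {0}. measure Q {n} = (\<alpha> + \<beta> / real n) * measure Q {n - 1})"

text \<open>
  The version with random parameters \<open>a(\<Theta>)\<close>, \<open>b(\<Theta>)\<close>, in which conditional probabilities given
  \<open>\<Theta>\<close> take the place of the point masses. The exceptional null set may depend on \<open>n\<close>.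
\<close>

definition mixed_panjer0 ::
  "'a measure \<Rightarrow> nat set \<Rightarrow> ('a \<Rightarrow> nat) \<Rightarrow> 'b::topological_space set \<Rightarrow> ('a \<Rightarrow> 'b) \<Rightarrow>
   ('b \<Rightarrow> real) \<Rightarrow> ('b \<Rightarrow> real) \<Rightarrow> bool" where
  "mixed_panjer0 M R N D \<Theta> a b \<longleftrightarrow>
     (\<forall>n\<in>R - {0}. AE \<omega> in M.
        cond_prob_given M D \<Theta> {\<omega> \<in> space M. N \<omega> = n} \<omega> =
        (a (\<Theta> \<omega>) + b (\<Theta> \<omega>) / real n) *
          cond_prob_given M D \<Theta> {\<omega> \<in> space M. N \<omega> = n - 1} \<omega>)"

end

theory Submission imports Defs begin

text \<open>
  Consistency says that, for almost all \<open>\<theta>\<close>, the measure \<open>P\<^sub>\<theta>\<close> gives \<open>\<Theta>\<^sup>-\<^sup>1[B]\<close> mass 1 or 0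
  according to whether \<open>\<theta> \<in> B\<close>.
  Integrating \<open>P\<^sub>\<theta>(E \<inter> \<Theta>\<^sup>-\<^sup>1[B])\<close> therefore gives the integral of \<open>P\<^sub>\<theta>(E)\<close> over \<open>B\<close>, so
  \<open>\<omega> \<mapsto> P\<^sub>\<Theta>\<^sub>(\<^sub>\<omega>\<^sub>)(E)\<close> is a version of \<open>P(E | \<Theta>)\<close>. Each recursion step thus transfers along the
  image measure of \<open>\<Theta>\<close>, and countably many null sets are collected.
\<close>

lemma subalgebra_vimage_algebra:
  assumes "f \<in> measurable M N"
  shows "subalgebra M (vimage_algebra (space M) f N)"
  unfolding subalgebra_def
  using measurable_sets[OF assms] measurable_space[OF assms]
  by (auto simp: sets_vimage_algebra2)

text \<open>Intersecting with an event of probability 1 changes no probability. Off \<open>B\<close>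
  the intersection is null, because the preimage of the complement of \<open>B\<close> has
  probability 1 and is disjoint from that of \<open>B\<close>.\<close>

lemma consistent_rcp_AE_inter:
  assumes rcp: "consistent_rcp M D \<Theta> Pt" and \<Theta>: "\<Theta> \<in> measurable M (borel_of D)"
    and E: "E \<in> sets M" and B: "B \<in> sets (borel_of D)"
  shows "AE \<theta> in law_on M D \<Theta>.
    measure (Pt \<theta>) (E \<inter> (\<Theta> -` B \<inter> space M)) = indicator B \<theta> * measure (Pt \<theta>) E"
proof -
  \<comment> \<open>Consistency for \<open>B\<close> is silent about \<theta> outside
    \<open>B\<close>; its instance for the complement within \<open>D\<close> covers those.\<close>
  have C: "space (borel_of D) - B \<in> sets (borel_of D)"
    using B by blast
  have "AE \<theta> in law_on M D \<Theta>. \<theta> \<in> B \<longrightarrow> measure (Pt \<theta>) (\<Theta> -` B \<inter> space M) = 1"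
    using rcp B unfolding consistent_rcp_def by blast
  moreover have "AE \<theta> in law_on M D \<Theta>. \<theta> \<in> space (borel_of D) - B \<longrightarrow>
      measure (Pt \<theta>) (\<Theta> -` (space (borel_of D) - B) \<inter> space M) = 1"
    using rcp C unfolding consistent_rcp_def by blast
  moreover have "AE \<theta> in law_on M D \<Theta>. \<theta> \<in> space (borel_of D)"
    using AE_space[of "law_on M D \<Theta>"] by (simp add: law_on_def)
  ultimately show ?thesis
  proof eventually_elim
    case (elim \<theta>)
    let ?T = "\<Theta> -` B \<inter> space M" and ?S = "\<Theta> -` (space (borel_of D) - B) \<inter> space M"
    \<comment> \<open>Only for parameters in \<open>D\<close> is \<open>Pt \<theta>\<close> known to
      be a probability measure with the events of \<open>M\<close>.\<close>
    from elim(3) have "\<theta> \<in> D"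
      by (simp add: space_restrict_space)
    with rcp interpret Q: prob_space "Pt \<theta>"
      by (simp add: consistent_rcp_def)
    have sets: "sets (Pt \<theta>) = sets M"
      using rcp \<open>\<theta> \<in> D\<close> by (simp add: consistent_rcp_def)
    have meas [simp]: "?T \<in> Q.events" "?S \<in> Q.events" "E \<in> Q.events"
      using measurable_sets[OF \<Theta>] B C E by (auto simp only: sets)
    show ?case
    proof (cases "\<theta> \<in> B")
      case True
      then have "AE x in Pt \<theta>. x \<in> ?T"
        using elim(1) Q.prob_eq_1[of ?T] by simp
      then have "Q.prob (E \<inter> ?T) = Q.prob E"
        by (intro Q.finite_measure_eq_AE) (auto elim: eventually_mono)
      with True show ?thesis by simp
    next
      case False
      then have "AE x in Pt \<theta>. x \<in> ?S"
        using elim(2,3) Q.prob_eq_1[of ?S] by simp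
      then have "Q.prob (E \<inter> ?T) = Q.prob {}"
        by (intro Q.finite_measure_eq_AE) (auto elim: eventually_mono)
      with False show ?thesis by simp
    qed
  qed
qed

text \<open>Every set of the \<sigma>-algebra generated by \<open>\<Theta>\<close> is a preimage of
  some \<open>B\<close>, so the averaging identity that characterizes conditional expectation has to
  be checked on such preimages only.\<close>

lemma cond_prob_given_consistent_rcp:
  assumes M: "prob_space M" and rcp: "consistent_rcp M D \<Theta> Pt"
    and \<Theta>: "\<Theta> \<in> measurable M (borel_of D)" and E: "E \<in> sets M"
  shows "AE \<omega> in M. cond_prob_given M D \<Theta> E \<omega> = measure (Pt (\<Theta> \<omega>)) E"
proof -
  interpret prob_space M by fact
  let ?F = "vimage_algebra (space M) \<Theta> (borel_of D)"
  let ?g = "\<lambda>\<theta>. measure (Pt \<theta>) E"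
  have space\<Theta>: "\<Theta> \<in> space M \<rightarrow> space (borel_of D)"
    using measurable_space[OF \<Theta>] by blast
  have sub: "subalgebra M ?F"
    using \<Theta> by (rule subalgebra_vimage_algebra)
  then interpret sigma_finite_subalgebra M ?F
    by (intro finite_measure_subalgebra_is_sigma_finite) (unfold_locales)
  have g: "?g \<in> borel_measurable (borel_of D)"
    using rcp E by (simp add: consistent_rcp_def)
  have g\<Theta>: "(\<lambda>\<omega>. ?g (\<Theta> \<omega>)) \<in> borel_measurable M"
    using \<Theta> g by (rule measurable_compose)
  \<comment> \<open>On a finite measure space this bound yields the integrability required of the
    candidate version.\<close>
  have bounded: "AE \<omega> in M. norm (?g (\<Theta> \<omega>)) \<le> 1"
  proof (rule AE_I2)
    fix \<omega> assume "\<omega> \<in> space M"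
    then have "prob_space (Pt (\<Theta> \<omega>))"
      using space\<Theta> rcp by (auto simp: consistent_rcp_def space_restrict_space)
    then show "norm (?g (\<Theta> \<omega>)) \<le> 1"
      by (simp add: prob_space.prob_le_1)
  qed
  have "AE \<omega> in M. real_cond_exp M ?F (indicator E) \<omega> = ?g (\<Theta> \<omega>)"
  proof (rule real_cond_exp_charact)
    fix A assume "A \<in> sets ?F"
    then obtain B where B: "B \<in> sets (borel_of D)" and A: "A = \<Theta> -` B \<inter> space M"
      unfolding sets_vimage_algebra2[OF space\<Theta>] by blast
    note [measurable] = g B
    have A': "A \<in> sets M"
      unfolding A using \<Theta> B by (rule measurable_sets)
    have "(\<integral>\<omega>\<in>A. indicator E \<omega> \<partial>M) = (\<integral>\<omega>. indicator (E \<inter> A) \<omega> \<partial>M)"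
      unfolding set_lebesgue_integral_def
      by (intro Bochner_Integration.integral_cong) (auto simp: indicator_def)
    also have "\<dots> = measure M (E \<inter> A)"
      using E A' by simp
    \<comment> \<open>The disintegration (d2) is applied to \<open>E \<inter> A\<close> rather than
      to \<open>E\<close>; consistency then turns \<open>A\<close> into the factor
      \<open>indicator B \<theta>\<close>.\<close>
    also have "\<dots> = (\<integral>\<theta>. measure (Pt \<theta>) (E \<inter> A) \<partial>law_on M D \<Theta>)"
      using rcp E A' by (simp add: consistent_rcp_def)
    also have "\<dots> = (\<integral>\<theta>. indicator B \<theta> * ?g \<theta> \<partial>law_on M D \<Theta>)"
    proof (rule integral_cong_AE)
      show "(\<lambda>\<theta>. measure (Pt \<theta>) (E \<inter> A)) \<in> borel_measurable (law_on M D \<Theta>)"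
        using rcp E A' by (simp add: consistent_rcp_def law_on_def)
      show "(\<lambda>\<theta>. indicator B \<theta> * ?g \<theta>) \<in> borel_measurable (law_on M D \<Theta>)"
        unfolding law_on_def measurable_distr_eq1 by measurable
      show "AE \<theta> in law_on M D \<Theta>. measure (Pt \<theta>) (E \<inter> A) = indicator B \<theta> * ?g \<theta>"
        unfolding A using rcp \<Theta> E B by (rule consistent_rcp_AE_inter)
    qed
    also have "\<dots> = (\<integral>\<omega>. indicator B (\<Theta> \<omega>) * ?g (\<Theta> \<omega>) \<partial>M)"
      unfolding law_on_def by (intro integral_distr \<Theta>) measurable
    also have "\<dots> = (\<integral>\<omega>\<in>A. ?g (\<Theta> \<omega>) \<partial>M)"
      unfolding set_lebesgue_integral_def
      by (intro Bochner_Integration.integral_cong) (auto simp: A indicator_def)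
    finally show "(\<integral>\<omega>\<in>A. indicator E \<omega> \<partial>M) = (\<integral>\<omega>\<in>A. ?g (\<Theta> \<omega>) \<partial>M)" .
  next
    show "integrable M (indicator E :: 'a \<Rightarrow> real)"
      using E by (intro integrable_real_indicator) (simp_all add: less_top[symmetric])
    show "integrable M (\<lambda>\<omega>. ?g (\<Theta> \<omega>))"
      using bounded g\<Theta> by (rule integrable_const_bound)
    show "(\<lambda>\<omega>. ?g (\<Theta> \<omega>)) \<in> borel_measurable ?F"
      using measurable_vimage_algebra1[OF space\<Theta>] g by (rule measurable_compose)
  qed
  then show ?thesis
    by (simp add: cond_prob_given_def)
qed

theorem proposition2p7:
  fixes M :: "'a measure"
    and N :: "'a \<Rightarrow> nat" and R :: "nat set"
    and \<Theta> :: "'a \<Rightarrow> real ^ 'd" and D :: "(real ^ 'd) set"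
    and Pt :: "real ^ 'd \<Rightarrow> 'a measure"
    and a b :: "real ^ 'd \<Rightarrow> real"
  assumes "prob_space M"
    and "N \<in> measurable M (count_space UNIV)" and "N \<in> space M \<rightarrow> R" and "0 \<in> R"
    and "\<Theta> \<in> borel_measurable M" and "\<Theta> \<in> space M \<rightarrow> D"
    and "consistent_rcp M D \<Theta> Pt"
    and "a \<in> borel_measurable (borel_of D)" and "b \<in> borel_measurable (borel_of D)"
  shows "mixed_panjer0 M R N D \<Theta> a b \<longleftrightarrow>
         (AE \<theta> in law_on M D \<Theta>.
            panjer0 R (a \<theta>) (b \<theta>) (distr (Pt \<theta>) (count_space UNIV) N))"
proof -
  note [measurable] = assms(8,9)
  let ?E = "\<lambda>n. {\<omega> \<in> space M. N \<omega> = n}"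
  let ?step = "\<lambda>n \<theta>. measure (Pt \<theta>) (?E n) =
    (a \<theta> + b \<theta> / real n) * measure (Pt \<theta>) (?E (n - 1))"
  have \<Theta>: "\<Theta> \<in> measurable M (borel_of D)"
    using assms(5,6) by (intro measurable_restrict_space2) auto
  have E: "?E n \<in> sets M" for n
    using assms(2) by measurable
  have [measurable]: "(\<lambda>\<theta>. measure (Pt \<theta>) (?E n)) \<in> borel_measurable (borel_of D)" for n
    using assms(7) E by (simp add: consistent_rcp_def)
  \<comment> \<open>The restriction to \<open>D\<close> ensures that \<open>N\<close> is measurable
    for \<open>Pt \<theta>\<close>, without which the image measure would not have these point
    masses.\<close>
  have point_mass: "measure (distr (Pt \<theta>) (count_space UNIV) N) {n} = measure (Pt \<theta>) (?E n)"
    if "\<theta> \<in> D" for \<theta> n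
  proof -
    have sets: "sets (Pt \<theta>) = sets M"
      using assms(7) that by (simp add: consistent_rcp_def)
    then have "N \<in> measurable (Pt \<theta>) (count_space UNIV)"
      using assms(2) by (simp cong: measurable_cong_sets)
    moreover have "N -` {n} \<inter> space (Pt \<theta>) = ?E n"
      using sets_eq_imp_space_eq[OF sets] by auto
    ultimately show ?thesis
      by (simp add: measure_distr)
  qed
  have "mixed_panjer0 M R N D \<Theta> a b \<longleftrightarrow> (\<forall>n\<in>R - {0}. AE \<omega> in M. ?step n (\<Theta> \<omega>))"
    unfolding mixed_panjer0_def
  proof (intro ball_cong refl)
    fix n
    \<comment> \<open>Stated for every \<open>k\<close>, since \<open>n - 1\<close> may lie outside
      \<open>R\<close>; the event \<open>?E (n - 1)\<close> is then empty.\<close>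
    have cp: "AE \<omega> in M. cond_prob_given M D \<Theta> (?E k) \<omega> = measure (Pt (\<Theta> \<omega>)) (?E k)" for k
      using assms(1,7) \<Theta> E by (rule cond_prob_given_consistent_rcp)
    show "(AE \<omega> in M. cond_prob_given M D \<Theta> (?E n) \<omega> =
        (a (\<Theta> \<omega>) + b (\<Theta> \<omega>) / real n) * cond_prob_given M D \<Theta> (?E (n - 1)) \<omega>) \<longleftrightarrow>
      (AE \<omega> in M. ?step n (\<Theta> \<omega>))"
      using cp[of n] cp[of "n - 1"] by (intro eventually_subst, eventually_elim) simp
  qed
  \<comment> \<open>The transfer works in both directions because the set of \<theta> satisfying
    \<open>?step n \<theta>\<close> is measurable, by (d1) and the measurability of \<open>a\<close>
    and \<open>b\<close>.\<close>
  also have "\<dots> \<longleftrightarrow> (\<forall>n\<in>R - {0}. AE \<theta> in law_on M D \<Theta>. ?step n \<theta>)"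
    unfolding law_on_def by (intro ball_cong refl AE_distr_iff[symmetric] \<Theta>) measurable
  \<comment> \<open>The null sets depending on \<open>n\<close> merge into one, as \<open>R\<close>
    is a set of naturals and hence countable.\<close>
  also have "\<dots> \<longleftrightarrow> (AE \<theta> in law_on M D \<Theta>. \<forall>n\<in>R - {0}. ?step n \<theta>)"
    by (rule AE_ball_countable[symmetric]) simp
  also have "\<dots> \<longleftrightarrow> (AE \<theta> in law_on M D \<Theta>.
      panjer0 R (a \<theta>) (b \<theta>) (distr (Pt \<theta>) (count_space UNIV) N))"
    \<comment> \<open>The congruence supplies that \<theta> lies in the space of the law, which is
      \<open>D\<close>, as \<open>point_mass\<close> demands.\<close>
    by (intro AE_cong ball_cong refl)
      (simp add: panjer0_def point_mass law_on_def space_restrict_space)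
  finally show ?thesis .
qed

end
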